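(* Let $G=\{G_t, 0\le t\le 1\}$ be a centered and continuous Gaussian process on the interval $[0,1]$, and let $\sigma^2=\sup_{0\le t\le 1}E[G_t^2]$ and $m=E[\sup_{0\le t\le 1}G_t]$. Let $\Theta\subset\mathbb{R}$, let $\theta_0\in\Theta$ be the true parameter, and for $\varepsilon>0$ let $X=\{X_t,0\le t\le 1\}$ be the solution of $X_t=x_0+\theta_0\int_0^t X_s\,ds+\varepsilon G_t$, $0\le t\le 1$. Let $\theta_\varepsilon^*$ be a minimum $L_1$-norm estimator of $\theta_0$ based on $X$. For $\delta>0$ define $$g(\delta)=\inf_{\theta\in\Theta,\ |\theta-\theta_0|>\delta}\int_0^1|x_t(\theta)-x_t(\theta_0)|\,dt,\qquad x_t(\theta)=x_0e^{\theta t}.$$ Then there exists a positive constant $C$ such that for every $\delta>0$, $$P_{\theta_0}^{(\varepsilon)}\{|\theta_\varepsilon^*-\theta_0|>\delta\}=O\left(e^{-C[g(\delta)]^2\varepsilon^{-2}}\right)\quad\text{as }\varepsilon\to 0.$$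
   Context: All processes are defined on a stochastic basis $(\Omega,\mathcal{F},(\mathcal{F}_t),P)$ satisfying the usual conditions, and are adapted to $(\mathcal{F}_t)$. The initial value $x_0\in\mathbb{R}$ is fixed and nonrandom, and $X_0=x_0$. The equation for $X$ is also written $dX_t=\theta X_t\,dt+\varepsilon\,dG_t$, $X_0=x_0$, with $\theta\in\Theta$ the unknown drift parameter. $P_{\theta_0}^{(\varepsilon)}$ denotes probability when the true parameter is $\theta_0$ and the noise level is $\varepsilon$. The function $x_t(\theta)=x_0e^{\theta t}$, $0\le t\le 1$, is the solution of the equation with $\varepsilon=0$. A minimum $L_1$-norm estimator $\theta_\varepsilon^*$ is a measurable selection with values in $\Theta$ satisfying $S_1(\theta_\varepsilon^* )=\inf_{\theta\in\Theta}S_1(\theta)$, where $S_1(\theta)=\int_0^1|X_t-x_t(\theta)|\,dt$. It is assumed that such a measurable selection exists. *)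

theory Defs
  imports "HOL-Probability.Probability"
begin

text \<open>
  A filtered probability space satisfying the usual conditions on the time interval $[0,1]$.
  The library locale for filtrations is indexed by a whole type; the values of \<open>F\<close> outside
  $[0,1]$ play no role (any filtration on $[0,1]$ extends by constants).
\<close>

locale stochastic_basis = prob_space M + complete_measure M + filtration "space M" F
  for M :: "'a measure" and F :: "real \<Rightarrow> 'a measure" +
  assumes sets_F_subset: "t \<in> {0..1} \<Longrightarrow> sets (F t) \<subseteq> sets M"
    and null_sets_F: "null_sets M \<subseteq> sets (F 0)"
    and right_continuous_F: "t \<in> {0..<1} \<Longrightarrow> sets (F t) = (\<Inter>s\<in>{t<..1}. sets (F s))"

definition adapted :: "(real \<Rightarrow> 'a measure) \<Rightarrow> (real \<Rightarrow> 'a \<Rightarrow> real) \<Rightarrow> bool" where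
  "adapted F X \<longleftrightarrow> (\<forall>t\<in>{0..1}. X t \<in> borel_measurable (F t))"

text \<open>The disjunct for constants is the degenerate normal law with variance $0$.\<close>

definition gaussian_rv :: "'a measure \<Rightarrow> ('a \<Rightarrow> real) \<Rightarrow> bool" where
  "gaussian_rv M Y \<longleftrightarrow> Y \<in> borel_measurable M \<and>
     (\<exists>\<mu> s. (s > 0 \<and> distributed M lborel Y (normal_density \<mu> s))
          \<or> (s = 0 \<and> (AE \<omega> in M. Y \<omega> = \<mu>)))"

definition gaussian_process :: "'a measure \<Rightarrow> (real \<Rightarrow> 'a \<Rightarrow> real) \<Rightarrow> bool" where
  "gaussian_process M G \<longleftrightarrow>
     (\<forall>J c. finite J \<and> J \<subseteq> {0..1} \<longrightarrow> gaussian_rv M (\<lambda>\<omega>. \<Sum>t\<in>J. c t * G t \<omega>))"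

definition centered_process :: "'a measure \<Rightarrow> (real \<Rightarrow> 'a \<Rightarrow> real) \<Rightarrow> bool" where
  "centered_process M G \<longleftrightarrow>
     (\<forall>t\<in>{0..1}. integrable M (G t) \<and> (\<integral>\<omega>. G t \<omega> \<partial>M) = 0)"

definition continuous_process :: "'a measure \<Rightarrow> (real \<Rightarrow> 'a \<Rightarrow> real) \<Rightarrow> bool" where
  "continuous_process M G \<longleftrightarrow> (AE \<omega> in M. continuous_on {0..1} (\<lambda>t. G t \<omega>))"

definition solves_sde ::
  "'a measure \<Rightarrow> real \<Rightarrow> real \<Rightarrow> real \<Rightarrow> (real \<Rightarrow> 'a \<Rightarrow> real) \<Rightarrow> (real \<Rightarrow> 'a \<Rightarrow> real) \<Rightarrow> bool" where
  "solves_sde M x0 \<theta>0 \<epsilon> G X \<longleftrightarrow>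
     (AE \<omega> in M. X 0 \<omega> = x0 \<and> set_integrable lborel {0..1} (\<lambda>s. X s \<omega>) \<and>
        (\<forall>t\<in>{0..1}. X t \<omega> = x0 + \<theta>0 * (LINT s:{0..t}|lborel. X s \<omega>) + \<epsilon> * G t \<omega>))"

definition ode_sol :: "real \<Rightarrow> real \<Rightarrow> real \<Rightarrow> real" where
  "ode_sol x0 \<theta> t = x0 * exp (\<theta> * t)"

definition S1 :: "real \<Rightarrow> (real \<Rightarrow> real) \<Rightarrow> real \<Rightarrow> real" where
  "S1 x0 x \<theta> = (LINT t:{0..1}|lborel. \<bar>x t - ode_sol x0 \<theta> t\<bar>)"

definition min_L1_estimator ::
  "'a measure \<Rightarrow> real \<Rightarrow> real set \<Rightarrow> (real \<Rightarrow> 'a \<Rightarrow> real) \<Rightarrow> ('a \<Rightarrow> real) \<Rightarrow> bool" where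
  "min_L1_estimator M x0 \<Theta> X \<theta>s \<longleftrightarrow>
     \<theta>s \<in> borel_measurable M \<and> (\<forall>\<omega>\<in>space M. \<theta>s \<omega> \<in> \<Theta>) \<and>
     (AE \<omega> in M. S1 x0 (\<lambda>t. X t \<omega>) (\<theta>s \<omega>) = (INF \<theta>\<in>\<Theta>. S1 x0 (\<lambda>t. X t \<omega>) \<theta>))"

text \<open>
  The separation function is extended-real valued, so that the infimum over the empty set is
  $+\infty$.
\<close>

definition separation :: "real \<Rightarrow> real set \<Rightarrow> real \<Rightarrow> real \<Rightarrow> ereal" where
  "separation x0 \<Theta> \<theta>0 \<delta> =
     (INF \<theta>\<in>{\<theta>\<in>\<Theta>. \<bar>\<theta> - \<theta>0\<bar> > \<delta>}.
        ereal (LINT t:{0..1}|lborel. \<bar>ode_sol x0 \<theta> t - ode_sol x0 \<theta>0 t\<bar>))"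

text \<open>$e^{-C \gamma^2 \varepsilon^{-2}}$ for $\gamma \in [0,\infty]$, with $e^{-\infty} = 0$.\<close>

definition exp_rate :: "real \<Rightarrow> ereal \<Rightarrow> real \<Rightarrow> real" where
  "exp_rate C \<gamma> \<epsilon> =
     (if \<gamma> = \<infinity> then 0 else exp (- C * (real_of_ereal \<gamma>)\<^sup>2 / \<epsilon>\<^sup>2))"

end

theory Submission
  imports Defs
begin

text \<open>
  By Gronwall's inequality $\int_0^1 |X_t - x_t(\theta_0)|\,dt \le \varepsilon e^{|\theta_0|}
  \sup_t |G_t|$, and minimality of the estimator bounds $\int_0^1 |x_t(\theta^*) -
  x_t(\theta_0)|\,dt$ by twice this quantity. So $|\theta^* - \theta_0| > \delta$ forces
  $\sup_t |G_t| \ge g(\delta) / (2 \varepsilon e^{|\theta_0|})$, and the claim is a Gaussian tail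
  bound for $\sup_t |G_t|$. It comes from Fernique's argument: for an independent copy $G'$ of $G$,
  the pair $((G - G')/\sqrt 2, (G + G')/\sqrt 2)$ has the same law as $(G, G')$, whence
  $P(\|G\| \le s)\,P(\|G\| > v) \le P(\|G\| > (v - s)/\sqrt 2)^2$, and this is iterated.
  The equality in law is needed only on rectangles over finitely many times, where it follows
  from Levy's uniqueness theorem on the line, applied to one coordinate after the other.
\<close>

section \<open>Equality in law on finite-dimensional rectangles via characteristic functions\<close>

text \<open>The hypotheses determine the characteristic function of the variable both under the
  original measure and under the measure tilted by the weight, so Levy's theorem applies to each.
  Subtracting the two resulting identities isolates \<open>R\<close> and \<open>S\<close>.\<close>

lemma weighted_char_unique_real:
  fixes X :: "'a \<Rightarrow> real" and Y :: "'b \<Rightarrow> real" and R :: "'a \<Rightarrow> real" and S :: "'b \<Rightarrow> real"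
  assumes "prob_space P" "prob_space Q"
    and X [measurable]: "X \<in> borel_measurable P" and Y [measurable]: "Y \<in> borel_measurable Q"
    and R [measurable]: "R \<in> borel_measurable P" and S [measurable]: "S \<in> borel_measurable Q"
    and bR: "\<And>x. \<bar>R x\<bar> \<le> 1" and bS: "\<And>y. \<bar>S y\<bar> \<le> 1"
    and eq1: "\<And>a. (CLINT x|P. iexp (a * X x)) = (CLINT y|Q. iexp (a * Y y))"
    and eqR: "\<And>a. (CLINT x|P. R x * iexp (a * X x)) = (CLINT y|Q. S y * iexp (a * Y y))"
    and A [measurable]: "A \<in> sets borel"
  shows "(LINT x|P. R x * indicator A (X x)) = (LINT y|Q. S y * indicator A (Y y))"
proof -
  interpret P: prob_space P by fact
  interpret Q: prob_space Q by fact
  have intR: "integrable P R"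
    by (rule P.integrable_const_bound[where B=1]) (use bR in auto)
  have intS: "integrable Q S"
    by (rule Q.integrable_const_bound[where B=1]) (use bS in auto)
  have intRe: "integrable P (\<lambda>x. complex_of_real (R x) * iexp (a * X x))" for a
    by (rule P.integrable_const_bound[where B=1]) (use bR in \<open>auto simp: norm_mult\<close>)
  have intSe: "integrable Q (\<lambda>x. complex_of_real (S x) * iexp (a * Y x))" for a
    by (rule Q.integrable_const_bound[where B=1]) (use bS in \<open>auto simp: norm_mult\<close>)
  have inte: "integrable P (\<lambda>x. iexp (a * X x))" for a
    by (rule P.integrable_const_bound[where B=1]) auto
  have intf: "integrable Q (\<lambda>x. iexp (a * Y x))" for a
    by (rule Q.integrable_const_bound[where B=1]) auto
  \<comment> \<open>The weights \<open>2 + R\<close> and \<open>2 + S\<close> are positive, so they can be normalised to probability densities.\<close>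
  define c where "c = 2 + (LINT x|P. R x)"
  \<comment> \<open>Frequency 0 shows that both weights have the same mean, so one constant
    \<open>c\<close> normalises both densities.\<close>
  have ES: "(LINT x|P. R x) = (LINT y|Q. S y)"
    using eqR[of 0] intR intS by (simp add: integral_complex_of_real)
  have "(LINT x|P. R x) \<ge> (LINT x|P. -1)"
    by (rule integral_mono) (use intR bR in \<open>auto simp: abs_le_iff minus_le_iff\<close>)
  then have c: "c \<ge> 1" by (simp add: c_def P.prob_space)
  have posR: "0 \<le> (2 + R x) / c" for x using c bR[of x] by (auto simp: abs_le_iff)
  have posS: "0 \<le> (2 + S y) / c" for y using c bS[of y] by (auto simp: abs_le_iff)
  define P' where "P' = density P (\<lambda>x. ennreal ((2 + R x) / c))"
  define Q' where "Q' = density Q (\<lambda>x. ennreal ((2 + S x) / c))"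
  have "(\<integral>\<^sup>+x. ennreal ((2 + R x) / c) \<partial>P) = ennreal (LINT x|P. (2 + R x) / c)"
    by (rule nn_integral_eq_integral) (use intR posR in auto)
  also have "(LINT x|P. (2 + R x) / c) = 1"
    using intR c by (simp add: c_def P.prob_space)
  finally have "prob_space P'"
    unfolding P'_def by (intro prob_spaceI) (auto simp: emeasure_density cong: nn_integral_cong)
  then interpret P': prob_space P' .
  have "(\<integral>\<^sup>+x. ennreal ((2 + S x) / c) \<partial>Q) = ennreal (LINT x|Q. (2 + S x) / c)"
    by (rule nn_integral_eq_integral) (use intS posS in auto)
  also have "(LINT x|Q. (2 + S x) / c) = 1"
    using intS c by (simp add: c_def Q.prob_space ES)
  finally have "prob_space Q'"
    unfolding Q'_def by (intro prob_spaceI) (auto simp: emeasure_density cong: nn_integral_cong)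
  then interpret Q': prob_space Q' .
  have X': "X \<in> borel_measurable P'" and Y': "Y \<in> borel_measurable Q'"
    by (simp_all add: P'_def Q'_def)
  have charP: "char (distr P' borel X) t =
      (2 * (CLINT x|P. iexp (t * X x)) + (CLINT x|P. R x * iexp (t * X x))) / c" for t
  proof -
    have "char (distr P' borel X) t = (CLINT x|P. ((2 + R x) / c) *\<^sub>R iexp (t * X x))"
      unfolding char_def using X' posR
      by (subst integral_distr) (auto simp: P'_def integral_density)
    also have "\<dots> = (CLINT x|P. (2 * iexp (t * X x) + R x * iexp (t * X x)) / c)"
      by (intro Bochner_Integration.integral_cong) (auto simp: scaleR_conv_of_real field_simps)
    finally show ?thesis using inte intRe by simp
  qed
  have charQ: "char (distr Q' borel Y) t =
      (2 * (CLINT x|Q. iexp (t * Y x)) + (CLINT x|Q. S x * iexp (t * Y x))) / c" for t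
  proof -
    have "char (distr Q' borel Y) t = (CLINT x|Q. ((2 + S x) / c) *\<^sub>R iexp (t * Y x))"
      unfolding char_def using Y' posS
      by (subst integral_distr) (auto simp: Q'_def integral_density)
    also have "\<dots> = (CLINT x|Q. (2 * iexp (t * Y x) + S x * iexp (t * Y x)) / c)"
      by (intro Bochner_Integration.integral_cong) (auto simp: scaleR_conv_of_real field_simps)
    finally show ?thesis using intf intSe by simp
  qed
  have eq': "distr P' borel X = distr Q' borel Y"
  proof (rule Levy_uniqueness)
    show "char (distr P' borel X) = char (distr Q' borel Y)"
      by (rule ext) (simp only: charP charQ eq1 eqR)
  qed (use X' Y' in auto)
  have "char (distr P borel X) = char (distr Q borel Y)"
    using eq1 by (auto simp: char_def integral_distr)
  then have eq: "distr P borel X = distr Q borel Y"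
    by (intro Levy_uniqueness) auto
  have intRA: "integrable P (\<lambda>x. R x * indicator A (X x))"
    by (rule P.integrable_const_bound[where B=1]) (use bR in \<open>auto split: split_indicator\<close>)
  have intSA: "integrable Q (\<lambda>x. S x * indicator A (Y x))"
    by (rule Q.integrable_const_bound[where B=1]) (use bS in \<open>auto split: split_indicator\<close>)
  have intA: "integrable P (\<lambda>x. indicator A (X x) :: real)" "integrable Q (\<lambda>x. indicator A (Y x) :: real)"
    by (rule P.integrable_const_bound[where B=1] Q.integrable_const_bound[where B=1];
        auto split: split_indicator)+
  have "(LINT x|P. ((2 + R x) / c) * indicator A (X x)) = (LINT z|distr P' borel X. indicator A z)"
    unfolding P'_def using posR by (subst integral_distr) (auto simp: integral_density)
  also have "\<dots> = (LINT y|Q. ((2 + S y) / c) * indicator A (Y y))"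
    unfolding eq' unfolding Q'_def using posS by (subst integral_distr) (auto simp: integral_density)
  finally have "2 * (LINT x|P. indicator A (X x)) + (LINT x|P. R x * indicator A (X x))
      = 2 * (LINT y|Q. indicator A (Y y)) + (LINT y|Q. S y * indicator A (Y y))"
    using intRA intSA intA c
    by (simp add: ring_distribs add_divide_distrib) (simp add: field_simps)
  moreover have "(LINT x|P. indicator A (X x) :: real) = (LINT z|distr P borel X. indicator A z)"
    by (subst integral_distr) auto
  moreover have "(LINT y|Q. indicator A (Y y) :: real) = (LINT z|distr Q borel Y. indicator A z)"
    by (subst integral_distr) auto
  ultimately show ?thesis by (simp add: eq)
qed

text \<open>Reduction to real weights: \<open>eqV\<close> carries over to the conjugate weights,
  hence to real and imaginary parts, which are again bounded by 1.\<close>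

lemma weighted_char_unique:
  fixes X :: "'a \<Rightarrow> real" and Y :: "'b \<Rightarrow> real" and V :: "'a \<Rightarrow> complex" and W :: "'b \<Rightarrow> complex"
  assumes "prob_space P" "prob_space Q"
    and X [measurable]: "X \<in> borel_measurable P" and Y [measurable]: "Y \<in> borel_measurable Q"
    and V [measurable]: "V \<in> borel_measurable P" and W [measurable]: "W \<in> borel_measurable Q"
    and bV: "\<And>x. norm (V x) \<le> 1" and bW: "\<And>y. norm (W y) \<le> 1"
    and eq1: "\<And>a. (CLINT x|P. iexp (a * X x)) = (CLINT y|Q. iexp (a * Y y))"
    and eqV: "\<And>a. (CLINT x|P. V x * iexp (a * X x)) = (CLINT y|Q. W y * iexp (a * Y y))"
    and A [measurable]: "A \<in> sets borel"
  shows "(CLINT x|P. V x * indicator A (X x)) = (CLINT y|Q. W y * indicator A (Y y))"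
proof -
  interpret P: prob_space P by fact
  interpret Q: prob_space Q by fact
  have intV: "integrable P (\<lambda>x. V x * iexp (a * X x))" for a
    by (rule P.integrable_const_bound[where B=1]) (use bV in \<open>auto simp: norm_mult\<close>)
  have intW: "integrable Q (\<lambda>x. W x * iexp (a * Y x))" for a
    by (rule Q.integrable_const_bound[where B=1]) (use bW in \<open>auto simp: norm_mult\<close>)
  have intVA: "integrable P (\<lambda>x. V x * indicator A (X x))"
    by (rule P.integrable_const_bound[where B=1]) (use bV in \<open>auto split: split_indicator\<close>)
  have intWA: "integrable Q (\<lambda>x. W x * indicator A (Y x))"
    by (rule Q.integrable_const_bound[where B=1]) (use bW in \<open>auto split: split_indicator\<close>)
  \<comment> \<open>Conjugation reverses the sign of the frequency, so \<open>eqV\<close> is used at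
    \<open>-a\<close>.\<close>
  have eqcV: "(CLINT x|P. cnj (V x) * iexp (a * X x)) = (CLINT y|Q. cnj (W y) * iexp (a * Y y))" for a
  proof -
    have "(CLINT x|P. cnj (V x * iexp ((-a) * X x))) = (CLINT y|Q. cnj (W y * iexp ((-a) * Y y)))"
      by (simp only: Bochner_Integration.integral_cnj eqV)
    then show ?thesis by (simp add: exp_cnj)
  qed
  have [measurable]: "cnj \<in> borel_measurable borel"
    by (intro borel_measurable_continuous_onI continuous_intros)
  have intcV: "integrable P (\<lambda>x. cnj (V x) * iexp (a * X x))" for a
    by (rule P.integrable_const_bound[where B=1]) (use bV in \<open>auto simp: norm_mult\<close>)
  have intcW: "integrable Q (\<lambda>x. cnj (W x) * iexp (a * Y x))" for a
    by (rule Q.integrable_const_bound[where B=1]) (use bW in \<open>auto simp: norm_mult\<close>)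
  have re: "complex_of_real (Re z) * w = (z * w + cnj z * w) / 2"
    and im: "complex_of_real (Im z) * w = (z * w - cnj z * w) / (2 * \<i>)" for z w
    by (simp_all add: complex_eq_iff)
  have eqRe: "(CLINT x|P. complex_of_real (Re (V x)) * iexp (a * X x))
      = (CLINT y|Q. complex_of_real (Re (W y)) * iexp (a * Y y))" for a
    unfolding re by (simp add: intV intW intcV intcW eqV eqcV del: of_real_mult)
  have eqIm: "(CLINT x|P. complex_of_real (Im (V x)) * iexp (a * X x))
      = (CLINT y|Q. complex_of_real (Im (W y)) * iexp (a * Y y))" for a
    unfolding im by (simp add: intV intW intcV intcW eqV eqcV del: of_real_mult)
  have "(LINT x|P. Re (V x) * indicator A (X x)) = (LINT y|Q. Re (W y) * indicator A (Y y))"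
    by (rule weighted_char_unique_real[OF assms(1,2) _ _ _ _ _ _ eq1 eqRe A])
      (auto intro: order_trans[OF abs_Re_le_cmod] bV bW)
  moreover have "(LINT x|P. Im (V x) * indicator A (X x)) = (LINT y|Q. Im (W y) * indicator A (Y y))"
    by (rule weighted_char_unique_real[OF assms(1,2) _ _ _ _ _ _ eq1 eqIm A])
      (auto intro: order_trans[OF abs_Im_le_cmod] bV bW)
  moreover have "Re (z * indicator A r) = Re z * indicator A r"
    "Im (z * indicator A r) = Im z * indicator A r" for z r
    by (auto split: split_indicator)
  ultimately show ?thesis
    using intVA intWA by (simp add: complex_eq_iff flip: integral_Re integral_Im)
qed

lemma integral_of_bool: "(LINT x|M. of_bool (\<phi> x) :: real) = measure M {x\<in>space M. \<phi> x}"
proof -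
  have "(LINT x|M. of_bool (\<phi> x) :: real) = (LINT x|M. indicator {x\<in>space M. \<phi> x} x)"
    by (intro Bochner_Integration.integral_cong) auto
  then show ?thesis by (simp add: Int_def conj_ac)
qed

text \<open>Each coordinate in turn plays the variable of \<open>weighted_char_unique\<close>, while
  the others are absorbed into the weight: as indicators once they have been treated, as
  exponentials before that. The exponentials are the reason for complex weights.\<close>

lemma cramer_wold_rectangles:
  fixes X :: "'i \<Rightarrow> 'a \<Rightarrow> real" and Y :: "'i \<Rightarrow> 'b \<Rightarrow> real"
  assumes "prob_space P" "prob_space Q" and I: "finite I"
    and X: "\<And>i. i \<in> I \<Longrightarrow> X i \<in> borel_measurable P" and Y: "\<And>i. i \<in> I \<Longrightarrow> Y i \<in> borel_measurable Q"
    and eq: "\<And>c. (CLINT x|P. iexp (\<Sum>i\<in>I. c i * X i x)) = (CLINT y|Q. iexp (\<Sum>i\<in>I. c i * Y i y))"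
    and A: "\<And>i. i \<in> I \<Longrightarrow> A i \<in> sets borel"
  shows "measure P {x\<in>space P. \<forall>i\<in>I. X i x \<in> A i} = measure Q {y\<in>space Q. \<forall>i\<in>I. Y i y \<in> A i}"
proof -
  interpret P: prob_space P by fact
  interpret Q: prob_space Q by fact
  \<comment> \<open>Replace the exponentials by indicators one coordinate at a time.\<close>
  have main: "J \<subseteq> I \<Longrightarrow> (CLINT x|P. (\<Prod>i\<in>J. indicator (A i) (X i x)) * iexp (\<Sum>i\<in>I-J. c i * X i x))
      = (CLINT y|Q. (\<Prod>i\<in>J. indicator (A i) (Y i y)) * iexp (\<Sum>i\<in>I-J. c i * Y i y))"
    if "finite J" for J c
    using that
  \<comment> \<open>The coefficients stay arbitrary because the induction step places every
    frequency \<open>a\<close> on the new coordinate \<open>j\<close>.\<close>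
  proof (induction J arbitrary: c rule: finite_induct)
    case empty
    then show ?case using eq by simp
  next
    case (insert j J)
    note [measurable] = X Y A
    have j: "j \<in> I" and J: "J \<subseteq> I" using insert by auto
    have split: "(\<Sum>i\<in>I-J. b i) = b j + (\<Sum>i\<in>I-insert j J. b i)" for b :: "'i \<Rightarrow> real"
    proof -
      have "I - J = insert j (I - insert j J)" using insert by auto
      then have "(\<Sum>i\<in>I-J. b i) = (\<Sum>i\<in>insert j (I - insert j J). b i)" by (rule arg_cong)
      also have "\<dots> = b j + (\<Sum>i\<in>I-insert j J. b i)" by (rule sum.insert) (use I in auto)
      finally show ?thesis .
    qed
    have bound: "norm ((\<Prod>i\<in>J. indicator (A i) (f i)) * iexp r) \<le> 1" for f r
      by (auto simp: norm_mult prod_norm[symmetric] indicator_def intro!: prod_le_1)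
    have one: "(CLINT x|P. iexp (a * X j x)) = (CLINT y|Q. iexp (a * Y j y))" for a
      using eq[of "\<lambda>i. if i = j then a else 0"] I j
      by (simp add: if_distrib[where f="\<lambda>x. x * _"] cong: if_cong)
    have "(CLINT x|P. ((\<Prod>i\<in>J. indicator (A i) (X i x)) * iexp (\<Sum>i\<in>I-insert j J. c i * X i x)) * indicator (A j) (X j x))
      = (CLINT y|Q. ((\<Prod>i\<in>J. indicator (A i) (Y i y)) * iexp (\<Sum>i\<in>I-insert j J. c i * Y i y)) * indicator (A j) (Y j y))"
    proof (rule weighted_char_unique[OF assms(1,2) _ _ _ _ bound bound one _ A[OF j]])
      fix a
      have "(\<Sum>i\<in>I - insert j J. (if i = j then a else c i) * f i) = (\<Sum>i\<in>I - insert j J. c i * f i)" for f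
        by (intro sum.cong) auto
      then show "(CLINT x|P. ((\<Prod>i\<in>J. indicator (A i) (X i x)) * iexp (\<Sum>i\<in>I-insert j J. c i * X i x)) * iexp (a * X j x))
        = (CLINT y|Q. ((\<Prod>i\<in>J. indicator (A i) (Y i y)) * iexp (\<Sum>i\<in>I-insert j J. c i * Y i y)) * iexp (a * Y j y))"
        using insert.IH[OF J, of "c(j := a)"]
        by (simp add: split exp_add ring_distribs mult_ac fun_upd_def)
    next
      have "i \<in> I" if "i \<in> J" for i using that J by auto
      then show "(\<lambda>x. (\<Prod>i\<in>J. indicator (A i) (X i x)) * iexp (\<Sum>i\<in>I-insert j J. c i * X i x)) \<in> borel_measurable P"
        "(\<lambda>x. (\<Prod>i\<in>J. indicator (A i) (Y i x)) * iexp (\<Sum>i\<in>I-insert j J. c i * Y i x)) \<in> borel_measurable Q"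
        by measurable
    qed (use j in auto)
    then show ?case using insert by (simp add: mult_ac)
  qed
  have ind: "(\<Prod>i\<in>I. indicator (A i) (f i) :: complex) = of_bool (\<forall>i\<in>I. f i \<in> A i)" for f
    using I by (induction I rule: finite_induct) (auto simp: indicator_def)
  note [measurable] = X Y A
  have cr: "of_bool b = complex_of_real (of_bool b)" for b by simp
  have "(LINT x|P. of_bool (\<forall>i\<in>I. X i x \<in> A i)) = (LINT y|Q. of_bool (\<forall>i\<in>I. Y i y \<in> A i) :: real)"
    using main[OF I order_refl, of "\<lambda>_. 0"] unfolding ind
    by (simp only: Diff_cancel sum.empty of_real_0 mult_zero_right exp_zero mult_1_right
        cr integral_complex_of_real of_real_eq_iff)
  then show ?thesis by (simp add: integral_of_bool)
qed

section \<open>Centered Gaussian laws and the rotation of two independent copies\<close>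

text \<open>The second moment alone determines the characteristic function, which reduces equality
  in law to equality of second moments. The degenerate law obeys the same formula with second moment
  0.\<close>

lemma (in prob_space) gaussian_rv_char:
  assumes L: "gaussian_rv M L" and mean: "expectation L = 0"
  shows "integrable M (\<lambda>\<omega>. (L \<omega>)\<^sup>2)"
    and "(CLINT \<omega>|M. iexp (L \<omega>)) = exp (- (LINT \<omega>|M. (L \<omega>)\<^sup>2) / 2)"
proof -
  have [measurable]: "L \<in> borel_measurable M" using L by (simp add: gaussian_rv_def)
  consider \<mu> s where "s > 0" "distributed M lborel L (normal_density \<mu> s)"
    | \<mu> where "AE \<omega> in M. L \<omega> = \<mu>"
    using L by (auto simp: gaussian_rv_def)
  then have "integrable M (\<lambda>\<omega>. (L \<omega>)\<^sup>2) \<and>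
    (CLINT \<omega>|M. iexp (L \<omega>)) = exp (- (LINT \<omega>|M. (L \<omega>)\<^sup>2) / 2)"
  proof cases
    case 1
    have "\<mu> = 0" using normal_distributed_expectation[OF 1] mean by simp
    with 1(2) have D: "distributed M lborel (\<lambda>\<omega>. L \<omega> / s) std_normal_density"
      using normal_standard_normal_convert[OF 1(1), of L 0] by simp
    have V: "(LINT \<omega>|M. (L \<omega>)\<^sup>2) = s\<^sup>2"
      using normal_distributed_variance[OF 1] mean by simp
    \<comment> \<open>Evaluation at \<open>s\<close> undoes the normalisation of \<open>L\<close> to
      unit variance.\<close>
    have "char std_normal_distribution s = (CLINT x|distr M lborel (\<lambda>\<omega>. L \<omega> / s). iexp (s * x))"
      unfolding char_def using distributed_distr_eq_density[OF D] by simp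
    also have "\<dots> = (CLINT \<omega>|M. iexp (s * (L \<omega> / s)))"
      by (rule integral_distr) auto
    also have "\<dots> = (CLINT \<omega>|M. iexp (L \<omega>))" using 1(1) by simp
    finally have "(CLINT \<omega>|M. iexp (L \<omega>)) = exp (- (LINT \<omega>|M. (L \<omega>)\<^sup>2) / 2)"
      by (simp add: char_std_normal_distribution V exp_of_real)
    \<comment> \<open>The Bochner integral of a non-integrable function is 0 by convention, whereas
      \<open>V\<close> gives the positive value \<open>s\<^sup>2\<close>.\<close>
    moreover have "integrable M (\<lambda>\<omega>. (L \<omega>)\<^sup>2)"
      by (rule ccontr) (use V 1(1) in \<open>auto simp: not_integrable_integral_eq\<close>)
    ultimately show ?thesis by blast
  next
    case 2
    have "expectation L = (LINT \<omega>|M. \<mu>)" by (rule integral_cong_AE) (use 2 in auto)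
    with mean have "\<mu> = 0" by (simp add: prob_space)
    with 2 have z: "AE \<omega> in M. L \<omega> = 0" by simp
    have "integrable M (\<lambda>\<omega>. (L \<omega>)\<^sup>2) \<longleftrightarrow> integrable M (\<lambda>\<omega>. 0::real)"
      by (rule integrable_cong_AE) (use z in auto)
    moreover have "(CLINT \<omega>|M. iexp (L \<omega>)) = (CLINT \<omega>|M. 1)"
      by (rule integral_cong_AE) (use z in auto)
    moreover have "(LINT \<omega>|M. (L \<omega>)\<^sup>2) = (LINT \<omega>|M. 0::real)"
      by (rule integral_cong_AE) (use z in auto)
    ultimately show ?thesis by (simp add: prob_space)
  qed
  then show "integrable M (\<lambda>\<omega>. (L \<omega>)\<^sup>2)"
    and "(CLINT \<omega>|M. iexp (L \<omega>)) = exp (- (LINT \<omega>|M. (L \<omega>)\<^sup>2) / 2)" by auto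
qed

lemma gaussian_process_measurable:
  assumes "gaussian_process M G" "t \<in> {0..1}"
  shows "G t \<in> borel_measurable M"
proof -
  have "gaussian_rv M (\<lambda>\<omega>. \<Sum>i\<in>{t}. 1 * G i \<omega>)"
    using assms(1)[unfolded gaussian_process_def, rule_format, of "{t}" "\<lambda>_. 1"] assms(2) by simp
  then show ?thesis by (simp add: gaussian_rv_def)
qed

text \<open>Passing to the normalised difference and sum is an orthogonal map, so it preserves the
  sum of second moments that determines the joint characteristic function. The product space
  provides the independent copy.\<close>

lemma gaussian_rotation:
  assumes "prob_space M" and G: "gaussian_process M G" and cent: "centered_process M G"
    and J: "finite J" "J \<subseteq> {0..1}"
    and A: "A \<in> sets borel" and B: "B \<in> sets borel"
  shows "measure (M \<Otimes>\<^sub>M M) {p\<in>space (M \<Otimes>\<^sub>M M). \<forall>t\<in>J.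
        (G t (fst p) - G t (snd p)) / sqrt 2 \<in> A \<and> (G t (fst p) + G t (snd p)) / sqrt 2 \<in> B}
    = measure M {\<omega>\<in>space M. \<forall>t\<in>J. G t \<omega> \<in> A} * measure M {\<omega>\<in>space M. \<forall>t\<in>J. G t \<omega> \<in> B}"
proof -
  interpret M: prob_space M by fact
  interpret PP: pair_prob_space M M ..
  have Gm: "G t \<in> borel_measurable M" if "t \<in> J" for t
    using gaussian_process_measurable[OF G] J that by auto
  note [measurable] = Gm A B
  define L where "L d \<omega> = (\<Sum>t\<in>J. d t * G t \<omega>)" for d \<omega>
  have Lm [measurable]: "L d \<in> borel_measurable M" for d
    unfolding L_def by measurable
  have "gaussian_rv M (L d)" for d
    unfolding L_def[abs_def] using G J by (simp add: gaussian_process_def)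
  moreover have "M.expectation (L d) = 0" for d
  proof -
    have GJ: "integrable M (G t)" "M.expectation (G t) = 0" if "t \<in> J" for t
      using cent J that by (auto simp: centered_process_def)
    then show ?thesis unfolding L_def by (subst Bochner_Integration.integral_sum) auto
  qed
  ultimately have sq: "integrable M (\<lambda>\<omega>. (L d \<omega>)\<^sup>2)"
    and ch: "(CLINT \<omega>|M. iexp (L d \<omega>)) = exp (- (LINT \<omega>|M. (L d \<omega>)\<^sup>2) / 2)" for d
    by (rule M.gaussian_rv_char; assumption)+
  have joint: "(CLINT p|M \<Otimes>\<^sub>M M. iexp (L d (fst p) + L e (snd p)))
      = exp (- ((LINT \<omega>|M. (L d \<omega>)\<^sup>2) + (LINT \<omega>|M. (L e \<omega>)\<^sup>2)) / 2)" for d e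
  proof -
    have "integrable (M \<Otimes>\<^sub>M M) (\<lambda>p. iexp (L d (fst p) + L e (snd p)))"
      by (rule PP.integrable_const_bound[where B=1]) auto
    then have "(CLINT p|M \<Otimes>\<^sub>M M. iexp (L d (fst p) + L e (snd p)))
        = (CLINT x|M. CLINT y|M. iexp (L d x + L e y))"
      by (subst PP.integral_fst'[symmetric]) auto
    also have "\<dots> = (CLINT x|M. iexp (L d x)) * (CLINT y|M. iexp (L e y))"
      by (simp add: ring_distribs exp_add)
    finally show ?thesis
      unfolding ch by (simp add: exp_of_real[symmetric] exp_add[symmetric] add_divide_distrib diff_divide_distrib)
  qed
  \<comment> \<open>The Boolean component of the index tells the two members of the pair apart,
    which turns a pair of processes into a single finite family.\<close>
  define X where "X i p = (if snd i then G (fst i) (snd p) else G (fst i) (fst p))"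
    for i :: "real \<times> bool" and p :: "'a \<times> 'a"
  define Y where "Y i p = (if snd i then (G (fst i) (fst p) + G (fst i) (snd p)) / sqrt 2
      else (G (fst i) (fst p) - G (fst i) (snd p)) / sqrt 2)"
    for i :: "real \<times> bool" and p :: "'a \<times> 'a"
  have eq: "(CLINT p|M \<Otimes>\<^sub>M M. iexp (\<Sum>i\<in>J \<times> UNIV. c i * Y i p))
      = (CLINT p|M \<Otimes>\<^sub>M M. iexp (\<Sum>i\<in>J \<times> UNIV. c i * X i p))" for c
  proof -
    define a b where "a t = c (t, False)" and "b t = c (t, True)" for t
    \<comment> \<open>Regrouping the rotated combination by copies leaves \<open>d\<close> as
      coefficients of the first copy and \<open>e\<close> as those of the second.\<close>
    define d e where "d t = (a t + b t) / sqrt 2" and "e t = (b t - a t) / sqrt 2" for t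
    have X: "(\<Sum>i\<in>J \<times> UNIV. c i * X i p) = L a (fst p) + L b (snd p)" for p
      by (simp add: X_def L_def a_def b_def sum.cartesian_product' UNIV_bool sum.distrib)
    have Y: "(\<Sum>i\<in>J \<times> UNIV. c i * Y i p) = L d (fst p) + L e (snd p)" for p
      by (simp add: Y_def L_def d_def e_def a_def b_def sum.cartesian_product' UNIV_bool
          sum.distrib[symmetric]) (simp add: field_simps)
    have "L d \<omega> = (L a \<omega> + L b \<omega>) / sqrt 2" "L e \<omega> = (L b \<omega> - L a \<omega>) / sqrt 2" for \<omega>
      by (simp_all add: L_def d_def e_def sum_divide_distrib sum.distrib[symmetric]
          sum_subtractf[symmetric] algebra_simps)
    \<comment> \<open>The parallelogram identity, exact because of the normalisation by
      \<open>sqrt 2\<close>.\<close>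
    then have par: "(L d \<omega>)\<^sup>2 + (L e \<omega>)\<^sup>2 = (L a \<omega>)\<^sup>2 + (L b \<omega>)\<^sup>2" for \<omega>
      by (simp add: power_divide power2_eq_square) (simp add: field_simps)
    have "(LINT \<omega>|M. (L d \<omega>)\<^sup>2) + (LINT \<omega>|M. (L e \<omega>)\<^sup>2)
        = (LINT \<omega>|M. (L a \<omega>)\<^sup>2) + (LINT \<omega>|M. (L b \<omega>)\<^sup>2)"
      unfolding Bochner_Integration.integral_add[OF sq sq, symmetric] par ..
    then show ?thesis unfolding X Y joint by simp
  qed
  have ball_bool: "(\<forall>i\<in>J\<times>UNIV. \<phi> i) \<longleftrightarrow> (\<forall>t\<in>J. \<phi> (t, False) \<and> \<phi> (t, True))" for \<phi>
    by (auto simp: all_bool_eq)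
  let ?S = "\<lambda>i::real\<times>bool. if snd i then B else A"
  have "measure (M \<Otimes>\<^sub>M M) {p\<in>space (M \<Otimes>\<^sub>M M). \<forall>i\<in>J\<times>UNIV. Y i p \<in> ?S i}
      = measure (M \<Otimes>\<^sub>M M) {p\<in>space (M \<Otimes>\<^sub>M M). \<forall>i\<in>J\<times>UNIV. X i p \<in> ?S i}"
  proof (rule cramer_wold_rectangles[OF PP.prob_space_axioms PP.prob_space_axioms _ _ _ eq])
    show "finite (J \<times> (UNIV::bool set))" using J by simp
  next
    fix i :: "real \<times> bool" assume "i \<in> J \<times> UNIV"
    then have [measurable]: "G (fst i) \<in> borel_measurable M" using Gm by auto
    show "Y i \<in> borel_measurable (M \<Otimes>\<^sub>M M)" "X i \<in> borel_measurable (M \<Otimes>\<^sub>M M)"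
      unfolding X_def Y_def by measurable
  qed (use A B in auto)
  also have "{p\<in>space (M \<Otimes>\<^sub>M M). \<forall>i\<in>J\<times>UNIV. X i p \<in> ?S i}
     = {\<omega>\<in>space M. \<forall>t\<in>J. G t \<omega> \<in> A} \<times> {\<omega>\<in>space M. \<forall>t\<in>J. G t \<omega> \<in> B}"
    unfolding ball_bool by (auto simp: X_def space_pair_measure)
  also have "{p\<in>space (M \<Otimes>\<^sub>M M). \<forall>i\<in>J\<times>UNIV. Y i p \<in> ?S i} = {p\<in>space (M \<Otimes>\<^sub>M M). \<forall>t\<in>J.
        (G t (fst p) - G t (snd p)) / sqrt 2 \<in> A \<and> (G t (fst p) + G t (snd p)) / sqrt 2 \<in> B}"
    unfolding ball_bool by (simp add: Y_def)
  also have "measure (M \<Otimes>\<^sub>M M) ({\<omega>\<in>space M. \<forall>t\<in>J. G t \<omega> \<in> A} \<times> {\<omega>\<in>space M. \<forall>t\<in>J. G t \<omega> \<in> B})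
     = measure M {\<omega>\<in>space M. \<forall>t\<in>J. G t \<omega> \<in> A} * measure M {\<omega>\<in>space M. \<forall>t\<in>J. G t \<omega> \<in> B}"
  proof -
    have "finite J" by fact
    then have "{\<omega>\<in>space M. \<forall>t\<in>J. G t \<omega> \<in> A} \<in> sets M" "{\<omega>\<in>space M. \<forall>t\<in>J. G t \<omega> \<in> B} \<in> sets M"
      by measurable
    then show ?thesis
      by (simp add: measure_def M.emeasure_pair_measure_Times enn2real_mult)
  qed
  finally show ?thesis .
qed

section \<open>Two analytic tools: iteration of a tail inequality, and Gronwall's inequality\<close>

text \<open>Since \<open>1 - q s \<ge> 3 / 4\<close>, the value of \<open>4 / 3 * q\<close> at
  \<open>t\<close> is at most the square of its value at \<open>(t - s) / sqrt 2\<close>, and at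
  \<open>s\<close> it is at most \<open>1 / 3\<close>. Repeated squaring against levels that grow
  like \<open>sqrt 2 ^ n\<close> amounts to Gaussian decay.\<close>

lemma fernique_iteration:
  fixes q :: "real \<Rightarrow> real"
  assumes mono: "\<And>u v. u \<le> v \<Longrightarrow> q v \<le> q u" and le1: "\<And>u. q u \<le> 1"
    and nonneg: "\<And>u. 0 \<le> q u" and s: "s > 0" "q s \<le> 1 / 4"
    and step: "\<And>t. (1 - q s) * q t \<le> (q ((t - s) / sqrt 2))\<^sup>2"
    and u: "u \<ge> 0"
  shows "q u \<le> exp (1 - u\<^sup>2 / (32 * s\<^sup>2))"
proof (cases "u < 4 * s")
  \<comment> \<open>For small \<open>u\<close> the claimed bound is at least 1, hence
    trivial.\<close>
  case True
  then have "u\<^sup>2 \<le> (4 * s)\<^sup>2" using u by (intro power_mono) auto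
  also have "\<dots> \<le> 32 * s\<^sup>2" by (simp add: power_mult_distrib)
  finally have "u\<^sup>2 / (32 * s\<^sup>2) \<le> 1" using s by simp
  then show ?thesis using le1[of u] by (meson order_trans one_le_exp_iff diff_ge_0_iff_ge)
next
  case False
  \<comment> \<open>The levels solve \<open>(t (Suc n) - s) / sqrt 2 = t n\<close>, so that
    \<open>step\<close> links consecutive ones.\<close>
  define t where "t n = rec_nat s (\<lambda>_ r. s + sqrt 2 * r) n" for n
  have t0: "t 0 = s" and tS: "t (Suc n) = s + sqrt 2 * t n" for n by (simp_all add: t_def)
  \<comment> \<open>This crude bound yields \<open>1 - 3 * sqrt 2 \<le> -3\<close>, so that the term
    \<open>- 3 * s\<close> in \<open>t_le\<close> absorbs the \<open>s\<close> added at each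
    step.\<close>
  have sqrt2: "4 / 3 \<le> sqrt 2" by (rule real_le_rsqrt) (simp add: power2_eq_square)
  have q_t: "q (t n) \<le> 3 / 4 * (1 / 3) ^ (2 ^ n)" for n
  proof (induction n)
    case 0
    then show ?case using s by (simp add: t0)
  next
    case (Suc n)
    have "3 / 4 * q (t (Suc n)) \<le> (1 - q s) * q (t (Suc n))"
      using s nonneg by (intro mult_right_mono) auto
    also have "\<dots> \<le> (q (t n))\<^sup>2" using step[of "t (Suc n)"] by (simp add: tS)
    also have "\<dots> \<le> (3 / 4 * (1 / 3) ^ (2 ^ n))\<^sup>2" using Suc nonneg by (intro power_mono)
    also have "\<dots> = 3 / 4 * (3 / 4 * (1 / 3) ^ (2 ^ Suc n))"
      by (simp add: mult_2 power_add power2_eq_square)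
    finally show ?case by simp
  qed
  have t_le: "t n \<le> 4 * s * sqrt 2 ^ n - 3 * s" for n
  proof (induction n)
    case 0
    then show ?case by (simp add: t0)
  next
    case (Suc n)
    have "t (Suc n) \<le> s + sqrt 2 * (4 * s * sqrt 2 ^ n - 3 * s)"
      unfolding tS using Suc by (intro add_left_mono mult_left_mono) auto
    also have "\<dots> = 4 * s * sqrt 2 ^ Suc n + (1 - 3 * sqrt 2) * s" by (simp add: algebra_simps)
    also have "(1 - 3 * sqrt 2) * s \<le> (-3) * s" using sqrt2 s by (intro mult_right_mono) auto
    finally show ?case by simp
  qed
  obtain k where "u\<^sup>2 / (32 * s\<^sup>2) < 2 ^ k" using real_arch_pow[of 2] by auto
  then have ex: "u\<^sup>2 < 32 * s\<^sup>2 * 2 ^ k" using s by (simp add: field_simps)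
  \<comment> \<open>Minimality pins \<open>u\<^sup>2\<close> between
    \<open>16 * s\<^sup>2 * 2 ^ n\<close> and twice that value. The lower bound puts
    \<open>u\<close> above the level \<open>t n\<close>; the upper one converts \<open>2 ^ n\<close>
    back to \<open>u\<^sup>2\<close>. For \<open>n = 0\<close> the lower bound is the case
    assumption \<open>u \<ge> 4 * s\<close>.\<close>
  define n where "n = (LEAST n. u\<^sup>2 < 32 * s\<^sup>2 * 2 ^ n)"
  have n: "u\<^sup>2 < 32 * s\<^sup>2 * 2 ^ n" unfolding n_def by (rule LeastI) (rule ex)
  have "16 * s\<^sup>2 * 2 ^ n \<le> u\<^sup>2"
  proof (cases n)
    case 0
    have "(4 * s)\<^sup>2 \<le> u\<^sup>2" using False s by (intro power_mono) auto
    then show ?thesis using 0 by (simp add: power_mult_distrib)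
  next
    case (Suc l)
    then have "\<not> u\<^sup>2 < 32 * s\<^sup>2 * 2 ^ l" unfolding n_def by (intro not_less_Least) auto
    then show ?thesis using Suc by simp
  qed
  also have "16 * s\<^sup>2 * 2 ^ n = (4 * s * sqrt 2 ^ n)\<^sup>2"
    by (simp add: power2_eq_square power_mult_distrib[symmetric])
  finally have "4 * s * sqrt 2 ^ n \<le> u" using u by (rule power2_le_imp_le)
  then have "q u \<le> q (t n)" using t_le[of n] s by (intro mono) linarith
  also have "\<dots> \<le> (1 / 3) ^ (2 ^ n)" using q_t[of n] by (rule order_trans) simp
  also have "\<dots> \<le> exp (-1) ^ (2 ^ n)"
    using exp_le by (intro power_mono) (auto simp: exp_minus field_simps)
  also have "\<dots> = exp (- (2 ^ n))" by (simp add: exp_of_nat_mult[symmetric])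
  also have "\<dots> \<le> exp (1 - u\<^sup>2 / (32 * s\<^sup>2))"
  proof -
    have "u\<^sup>2 / (32 * s\<^sup>2) < 2 ^ n" using n s by (simp add: field_simps)
    then show ?thesis by simp
  qed
  finally show ?thesis .
qed

text \<open>Let \<open>H t\<close> be the integral of the absolute value up to \<open>t\<close>.
  Then \<open>exp (- a * t) * H t - b * t\<close> has nonpositive derivative, because the derivative
  of \<open>H\<close> is at most \<open>a * H t + b\<close> and the exponential factor is at most 1.
  The mean value theorem compares the endpoints.\<close>

lemma gronwall_integral_bound:
  fixes d :: "real \<Rightarrow> real"
  assumes cont: "continuous_on {0..1} d" and a: "a \<ge> 0" and b: "b \<ge> 0"
    and le: "\<And>t. t \<in> {0..1} \<Longrightarrow> \<bar>d t\<bar> \<le> a * integral {0..t} (\<lambda>s. \<bar>d s\<bar>) + b"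
  shows "integral {0..1} (\<lambda>s. \<bar>d s\<bar>) \<le> b * exp a"
proof -
  let ?H = "\<lambda>t. integral {0..t} (\<lambda>s. \<bar>d s\<bar>)"
  have c: "continuous_on {0..1} (\<lambda>s. \<bar>d s\<bar>)" using cont by (intro continuous_intros)
  have H: "(?H has_real_derivative \<bar>d t\<bar>) (at t within {0..1})" if "t \<in> {0..1}" for t
    using integral_has_real_derivative[OF c that] .
  let ?\<phi> = "\<lambda>t. exp (- a * t) * ?H t - b * t"
  let ?\<phi>' = "\<lambda>t. exp (- a * t) * (\<bar>d t\<bar> - a * ?H t) - b"
  have "(?\<phi> has_derivative (*) (?\<phi>' t)) (at t within {0..1})" if "t \<in> {0..1}" for t
    unfolding has_field_derivative_def[symmetric]
    by (rule derivative_eq_intros H[OF that] refl | simp)+ (simp add: algebra_simps)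
  then have "\<exists>t\<in>{0<..<1}. ?\<phi> 1 - ?\<phi> 0 = ?\<phi>' t * (1 - 0)"
    by (intro mvt_simple) auto
  then obtain t where "t \<in> {0<..<1}" and t_eq: "?\<phi> 1 - ?\<phi> 0 = ?\<phi>' t * (1 - 0)"
    by (elim bexE)
  then have t: "0 < t" "t < 1" by auto
  have "exp (- a * t) * (\<bar>d t\<bar> - a * ?H t) \<le> exp (- a * t) * b"
    using le[of t] t by (intro mult_left_mono) auto
  also have "\<dots> \<le> 1 * b"
    using t a b by (intro mult_right_mono) auto
  finally have "?\<phi>' t \<le> 0" by simp
  then have "exp (- a) * ?H 1 \<le> b" using t_eq by simp
  then show ?thesis by (simp add: exp_minus field_simps)
qed

section \<open>Tail of the supremum of a Gaussian process\<close>

text \<open>By rotation invariance the left-hand side is the probability that the normalised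
  difference of two independent copies stays within \<open>s\<close> on \<open>J\<close> while their
  normalised sum exceeds \<open>v\<close> in absolute value somewhere. At such a time both copies
  exceed \<open>(v - s) / sqrt 2\<close> in absolute value, and independence gives the
  square.\<close>

lemma gaussian_exceedance_rotation:
  assumes "prob_space M" and G: "gaussian_process M G" and cent: "centered_process M G"
    and J: "finite J" "J \<subseteq> {0..1}"
  defines "q \<equiv> \<lambda>u. measure M {\<omega>\<in>space M. \<exists>t\<in>J. \<bar>G t \<omega>\<bar> > u}"
  shows "(1 - q s) * q v \<le> (q ((v - s) / sqrt 2))\<^sup>2"
proof -
  interpret M: prob_space M by fact
  interpret PP: pair_prob_space M M ..
  have [measurable]: "G t \<in> borel_measurable M" if "t \<in> J" for t
    using gaussian_process_measurable[OF G] J that by auto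
  have [measurable]: "countable J" using J by (simp add: countable_finite)
  let ?N = "\<lambda>u. {\<omega>\<in>space M. \<exists>t\<in>J. \<bar>G t \<omega>\<bar> > u}"
  have N [measurable]: "?N u \<in> sets M" for u
    by measurable
  have abs: "x \<in> {-w..w} \<longleftrightarrow> \<bar>x\<bar> \<le> w" for x w :: real by auto
  have compl: "measure M {\<omega>\<in>space M. \<forall>t\<in>J. G t \<omega> \<in> {-u..u}} = 1 - q u" for u
  proof -
    have "{\<omega>\<in>space M. \<forall>t\<in>J. G t \<omega> \<in> {-u..u}} = space M - ?N u"
      unfolding abs by (auto simp: not_less)
    then show ?thesis unfolding q_def using M.prob_compl[OF N] by simp
  qed
  let ?U = "\<lambda>t p. (G t (fst p) - G t (snd p)) / sqrt 2"
  let ?V = "\<lambda>t p. (G t (fst p) + G t (snd p)) / sqrt 2"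
  let ?E = "\<lambda>B. {p\<in>space (M \<Otimes>\<^sub>M M). \<forall>t\<in>J. ?U t p \<in> {-s..s} \<and> ?V t p \<in> B}"
  have E: "?E B \<in> sets (M \<Otimes>\<^sub>M M)" if [measurable]: "B \<in> sets borel" for B
    by measurable
  \<comment> \<open>\<open>gaussian_rotation\<close> treats conditions imposed at all times of
    \<open>J\<close>, so exceedance of \<open>v\<close> is expressed as a difference of two such
    events.\<close>
  have "measure (M \<Otimes>\<^sub>M M) (?E UNIV - ?E {-v..v}) = (1 - q s) * 1 - (1 - q s) * (1 - q v)"
    using gaussian_rotation[OF assms(1) G cent J, of "{-s..s}" UNIV]
      gaussian_rotation[OF assms(1) G cent J, of "{-s..s}" "{-v..v}"]
    by (subst PP.finite_measure_Diff[OF E E]) (auto simp: compl M.prob_space simp del: atLeastAtMost_iff)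
  also have "\<dots> = (1 - q s) * q v" by (simp add: algebra_simps)
  finally have "(1 - q s) * q v = measure (M \<Otimes>\<^sub>M M) (?E UNIV - ?E {-v..v})" ..
  also have "\<dots> \<le> measure (M \<Otimes>\<^sub>M M) (?N ((v - s) / sqrt 2) \<times> ?N ((v - s) / sqrt 2))"
  proof (rule PP.finite_measure_mono)
    show "?E UNIV - ?E {-v..v} \<subseteq> ?N ((v - s) / sqrt 2) \<times> ?N ((v - s) / sqrt 2)"
    proof
      fix p assume p: "p \<in> ?E UNIV - ?E {-v..v}"
      then obtain t where t: "t \<in> J" "\<bar>?U t p\<bar> \<le> s" "\<bar>?V t p\<bar> > v"
        unfolding abs by (auto simp: not_le)
      \<comment> \<open>Inverting the rotation recovers each copy from the difference
        \<open>x\<close> and the sum \<open>y\<close>.\<close>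
      define x y where "x = ?U t p" and "y = ?V t p"
      have "(y + x) / sqrt 2 = (G t (fst p) + G t (fst p)) / (sqrt 2 * sqrt 2)"
        by (simp add: x_def y_def field_simps)
      then have fst: "G t (fst p) = (y + x) / sqrt 2" by simp
      have "(y - x) / sqrt 2 = (G t (snd p) + G t (snd p)) / (sqrt 2 * sqrt 2)"
        by (simp add: x_def y_def field_simps)
      then have snd: "G t (snd p) = (y - x) / sqrt 2" by simp
      have "\<bar>y + x\<bar> > v - s" "\<bar>y - x\<bar> > v - s"
        using t(2,3) unfolding x_def[symmetric] y_def[symmetric] by arith+
      then have "(v - s) / sqrt 2 < \<bar>G t (fst p)\<bar>" "(v - s) / sqrt 2 < \<bar>G t (snd p)\<bar>"
        unfolding fst snd by (simp_all add: abs_divide divide_strict_right_mono)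
      then show "p \<in> ?N ((v - s) / sqrt 2) \<times> ?N ((v - s) / sqrt 2)"
        using p t(1) by (cases p) (auto simp: space_pair_measure)
    qed
  qed measurable
  also have "\<dots> = (q ((v - s) / sqrt 2))\<^sup>2"
    by (simp add: measure_def M.emeasure_pair_measure_Times enn2real_mult q_def power2_eq_square)
  finally show ?thesis .
qed

text \<open>The threshold \<open>s\<close> for \<open>D\<close> serves every finite subset as well,
  so the bound is uniform over finite subsets and survives the limit along an increasing sequence of
  them.\<close>

theorem gaussian_fernique_tail:
  assumes "prob_space M" and G: "gaussian_process M G" and cent: "centered_process M G"
    and D: "countable D" "D \<subseteq> {0..1}" and s: "s > 0"
    and quart: "measure M {\<omega>\<in>space M. \<exists>t\<in>D. \<bar>G t \<omega>\<bar> > s} \<le> 1 / 4" and u: "u \<ge> 0"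
  shows "measure M {\<omega>\<in>space M. \<exists>t\<in>D. \<bar>G t \<omega>\<bar> > u} \<le> exp (1 - u\<^sup>2 / (32 * s\<^sup>2))"
proof -
  interpret M: prob_space M by fact
  have Gm [measurable]: "G t \<in> borel_measurable M" if "t \<in> D" for t
    using gaussian_process_measurable[OF G] D that by auto
  note [measurable] = D(1)
  have fin: "measure M {\<omega>\<in>space M. \<exists>t\<in>J. \<bar>G t \<omega>\<bar> > u} \<le> exp (1 - u\<^sup>2 / (32 * s\<^sup>2))"
    if J: "finite J" "J \<subseteq> D" for J
  proof -
    let ?q = "\<lambda>u. measure M {\<omega>\<in>space M. \<exists>t\<in>J. \<bar>G t \<omega>\<bar> > u}"
    have [measurable]: "G t \<in> borel_measurable M" if "t \<in> J" for t using that J by auto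
    have [measurable]: "countable J" using J by (simp add: countable_finite)
    have "?q s \<le> measure M {\<omega>\<in>space M. \<exists>t\<in>D. \<bar>G t \<omega>\<bar> > s}"
      using J by (intro M.finite_measure_mono) auto
    then have qs: "?q s \<le> 1 / 4" using quart by linarith
    show ?thesis
    proof (rule fernique_iteration[where q = ?q])
      fix v w :: real assume "v \<le> w"
      then have "{\<omega>\<in>space M. \<exists>t\<in>J. \<bar>G t \<omega>\<bar> > w} \<subseteq> {\<omega>\<in>space M. \<exists>t\<in>J. \<bar>G t \<omega>\<bar> > v}"
        by (blast intro: le_less_trans)
      then show "?q w \<le> ?q v" by (intro M.finite_measure_mono) auto
    next
      fix t
      show "(1 - ?q s) * ?q t \<le> (?q ((t - s) / sqrt 2))\<^sup>2"
        using J D by (intro gaussian_exceedance_rotation assms) auto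
    qed (use s qs u in auto)
  qed
  show ?thesis
  proof (cases "D = {}")
    case True
    then show ?thesis by simp
  next
    case False
    define J where "J n = from_nat_into D ` {..n}" for n
    define A where "A n = {\<omega>\<in>space M. \<exists>t\<in>J n. \<bar>G t \<omega>\<bar> > u}" for n
    have J: "finite (J n)" "J n \<subseteq> D" for n
      using False by (auto simp: J_def intro: from_nat_into)
    have "A n \<in> sets M" for n
    proof -
      have [measurable]: "G t \<in> borel_measurable M" if "t \<in> J n" for t
        by (rule Gm[OF subsetD[OF J(2) that]])
      have [measurable]: "countable (J n)" using J(1) by (rule countable_finite)
      show ?thesis unfolding A_def by measurable
    qed
    then have "(\<lambda>n. measure M (A n)) \<longlonglongrightarrow> measure M (\<Union>n. A n)"
      by (intro M.finite_Lim_measure_incseq incseq_SucI) (auto simp: A_def J_def)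
    moreover have "(\<Union>n. A n) = {\<omega>\<in>space M. \<exists>t\<in>D. \<bar>G t \<omega>\<bar> > u}"
    proof -
      have "D = (\<Union>n. J n)"
        using J(2) from_nat_into_surj[OF D(1)] by (fastforce simp: J_def)
      then show ?thesis by (auto simp: A_def)
    qed
    ultimately have "(\<lambda>n. measure M (A n)) \<longlonglongrightarrow> measure M {\<omega>\<in>space M. \<exists>t\<in>D. \<bar>G t \<omega>\<bar> > u}"
      by simp
    then show ?thesis
      by (rule LIMSEQ_le_const2) (use fin[OF J] in \<open>auto simp: A_def\<close>)
  qed
qed

lemma closure_Rats_Int_unit: "closure ({0<..<1} \<inter> \<rat>) = {0..1::real}"
  by (subst closure_open_Int_superset) (auto simp: Rats_closure_real)

text \<open>Continuous paths are bounded on the compact interval, so the exceedance events decrease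
  to a null set. This supplies the starting level for Fernique's argument.\<close>

lemma continuous_process_tight:
  assumes "prob_space M" and G: "gaussian_process M G" and cont: "continuous_process M G"
    and D: "countable D" "D \<subseteq> {0..1}" and \<eta>: "\<eta> > 0"
  obtains s where "s > 0" "measure M {\<omega>\<in>space M. \<exists>t\<in>D. \<bar>G t \<omega>\<bar> > s} \<le> \<eta>"
proof -
  interpret M: prob_space M by fact
  have Gm [measurable]: "G t \<in> borel_measurable M" if "t \<in> D" for t
    using gaussian_process_measurable[OF G] D that by auto
  note [measurable] = D(1)
  let ?A = "\<lambda>n::nat. {\<omega>\<in>space M. \<exists>t\<in>D. \<bar>G t \<omega>\<bar> > real n}"
  have meas: "?A n \<in> sets M" for n by measurable
  have "(\<lambda>n. measure M (?A n)) \<longlonglongrightarrow> measure M (\<Inter>n. ?A n)"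
  proof (rule M.finite_Lim_measure_decseq)
    show "range ?A \<subseteq> sets M" using meas by auto
    show "decseq ?A" by (rule decseq_SucI) force
  qed
  moreover have "measure M (\<Inter>n. ?A n) = measure M {}"
  proof (rule M.finite_measure_eq_AE)
    have "AE \<omega> in M. continuous_on {0..1} (\<lambda>t. G t \<omega>)"
      using cont by (simp add: continuous_process_def)
    then show "AE \<omega> in M. \<omega> \<in> (\<Inter>n. ?A n) \<longleftrightarrow> \<omega> \<in> {}"
    proof eventually_elim
      case (elim \<omega>)
      then have "bounded ((\<lambda>t. G t \<omega>) ` {0..1})"
        by (intro compact_imp_bounded compact_continuous_image) auto
      then obtain b where b: "\<forall>t\<in>{0..1}. \<bar>G t \<omega>\<bar> \<le> b"
        unfolding bounded_iff by auto
      obtain n where "b \<le> real n" using real_arch_simple by blast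
      then have "\<omega> \<notin> ?A n" using b D by (fastforce simp: not_less)
      then show ?case by blast
    qed
  qed (use meas in auto)
  ultimately have "(\<lambda>n. measure M (?A n)) \<longlonglongrightarrow> 0" by simp
  then have "eventually (\<lambda>n. measure M (?A n) < \<eta>) sequentially"
    using \<eta> by (rule order_tendstoD)
  then obtain n where "measure M (?A n) < \<eta>" "n > 0"
    using eventually_conj[OF _ eventually_gt_at_top[of 0]] eventually_happens'[OF sequentially_bot]
    by (metis (mono_tags, lifting))
  then show thesis by (intro that[of "real n"]) auto
qed

section \<open>Deterministic path estimates for the perturbed equation\<close>

lemma ode_sol_continuous: "continuous_on S (ode_sol x0 \<theta>)"
  unfolding ode_sol_def[abs_def] by (intro continuous_intros)

text \<open>Puts the noise-free solution in the integral form of the perturbed equation, so that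
  subtraction leaves a linear equation driven by the noise alone.\<close>

lemma ode_sol_integral_equation:
  assumes "t \<ge> 0"
  shows "ode_sol x0 \<theta> t = x0 + \<theta> * integral {0..t} (ode_sol x0 \<theta>)"
proof -
  have "((\<lambda>s. \<theta> * ode_sol x0 \<theta> s) has_integral ode_sol x0 \<theta> t - ode_sol x0 \<theta> 0) {0..t}"
    using assms unfolding ode_sol_def
    by (intro fundamental_theorem_of_calculus)
      (auto intro!: derivative_eq_intros simp: has_real_derivative_iff_has_vector_derivative[symmetric])
  from integral_unique[OF this] show ?thesis by (simp add: ode_sol_def[abs_def])
qed

lemma S1_eq_integral:
  assumes "continuous_on {0..1} x"
  shows "S1 x0 x \<theta> = integral {0..1} (\<lambda>t. \<bar>x t - ode_sol x0 \<theta> t\<bar>)"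
  unfolding S1_def
  by (intro set_borel_integral_eq_integral borel_integrable_atLeastAtMost' continuous_intros
      ode_sol_continuous assms)

text \<open>The deviation \<open>d\<close> from the noise-free solution satisfies
  \<open>d t = \<theta> * integral {0..t} d + \<epsilon> * g t\<close>, to which Gronwall's
  inequality applies with \<open>a = \<bar>\<theta>\<bar>\<close> and
  \<open>b = \<epsilon> * u\<close>.\<close>

lemma sde_path_bounds:
  assumes int: "set_integrable lborel {0..1} x" and g: "continuous_on {0..1} g"
    and eq: "\<And>t. t \<in> {0..1} \<Longrightarrow> x t = x0 + \<theta> * (LINT s:{0..t}|lborel. x s) + \<epsilon> * g t"
    and bound: "\<And>t. t \<in> {0..1} \<Longrightarrow> \<bar>g t\<bar> \<le> u" and \<epsilon>: "\<epsilon> > 0"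
  shows "continuous_on {0..1} x" and "S1 x0 x \<theta> \<le> \<epsilon> * u * exp \<bar>\<theta>\<bar>"
proof -
  have int01: "x integrable_on {0..1}"
    using set_borel_integral_eq_integral(1)[OF int] .
  have eq': "x t = x0 + \<theta> * integral {0..t} x + \<epsilon> * g t" if "t \<in> {0..1}" for t
  proof -
    have "set_integrable lborel {0..t} x"
      using int that by (rule_tac set_integrable_subset) auto
    then show ?thesis using eq[OF that] set_borel_integral_eq_integral(2) by metis
  qed
  \<comment> \<open>Integrability of \<open>x\<close> makes its indefinite integral continuous, so
    the equation itself shows that \<open>x\<close> is continuous.\<close>
  have "continuous_on {0..1} (\<lambda>t. x0 + \<theta> * integral {0..t} x + \<epsilon> * g t)"
    by (intro continuous_intros g indefinite_integral_continuous_1 int01)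
  then show cx: "continuous_on {0..1} x"
    by (rule continuous_on_eq) (simp add: eq')
  define d where "d t = x t - ode_sol x0 \<theta> t" for t
  have cd: "continuous_on {0..1} d"
    unfolding d_def by (intro continuous_intros cx ode_sol_continuous)
  have "integral {0..1} (\<lambda>t. \<bar>d t\<bar>) \<le> (\<epsilon> * u) * exp \<bar>\<theta>\<bar>"
  proof (rule gronwall_integral_bound[OF cd])
    show "0 \<le> \<epsilon> * u" using bound[of 0] \<epsilon> by (intro mult_nonneg_nonneg) auto
  next
    fix t :: real assume t: "t \<in> {0..1}"
    then have sub: "{0..t} \<subseteq> {0..1}" by auto
    have "x integrable_on {0..t}" "ode_sol x0 \<theta> integrable_on {0..t}"
      by (intro integrable_continuous_real ode_sol_continuous continuous_on_subset[OF cx sub])+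
    then have "d t = \<theta> * integral {0..t} d + \<epsilon> * g t"
      using eq'[OF t] ode_sol_integral_equation[of t x0 \<theta>] t
      unfolding d_def by (subst integral_diff) (auto simp: algebra_simps)
    then have "\<bar>d t\<bar> \<le> \<bar>\<theta>\<bar> * \<bar>integral {0..t} d\<bar> + \<epsilon> * \<bar>g t\<bar>"
      using \<epsilon> abs_triangle_ineq[of "\<theta> * integral {0..t} d" "\<epsilon> * g t"] by (simp add: abs_mult)
    moreover have "\<bar>integral {0..t} d\<bar> \<le> integral {0..t} (\<lambda>s. \<bar>d s\<bar>)"
      unfolding real_norm_def[symmetric] using continuous_on_subset[OF cd sub]
      by (intro integral_norm_bound_integral integrable_continuous_real continuous_intros) auto
    ultimately show "\<bar>d t\<bar> \<le> \<bar>\<theta>\<bar> * integral {0..t} (\<lambda>s. \<bar>d s\<bar>) + \<epsilon> * u"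
      using bound[OF t] \<epsilon> by (elim order_trans) (intro add_mono mult_left_mono, auto)
  qed simp
  then show "S1 x0 x \<theta> \<le> \<epsilon> * u * exp \<bar>\<theta>\<bar>"
    by (simp add: S1_eq_integral[OF cx] d_def)
qed

lemma ode_sol_dist_le_S1:
  assumes x: "continuous_on {0..1} x"
  shows "(LINT t:{0..1}|lborel. \<bar>ode_sol x0 \<theta> t - ode_sol x0 \<theta>' t\<bar>) \<le> S1 x0 x \<theta> + S1 x0 x \<theta>'"
proof -
  have int: "set_integrable lborel {0..1} (\<lambda>t. \<bar>x t - ode_sol x0 \<theta> t\<bar>)" for \<theta>
    by (intro borel_integrable_atLeastAtMost' continuous_intros ode_sol_continuous x)
  have "set_integrable lborel {0..1} (\<lambda>t. \<bar>ode_sol x0 \<theta> t - ode_sol x0 \<theta>' t\<bar>)"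
    by (intro borel_integrable_atLeastAtMost' continuous_intros ode_sol_continuous)
  then have "(LINT t:{0..1}|lborel. \<bar>ode_sol x0 \<theta> t - ode_sol x0 \<theta>' t\<bar>)
      \<le> (LINT t:{0..1}|lborel. \<bar>x t - ode_sol x0 \<theta> t\<bar> + \<bar>x t - ode_sol x0 \<theta>' t\<bar>)"
    using int by (intro set_integral_mono) auto
  then show ?thesis unfolding S1_def using int by (simp add: set_integral_add)
qed

lemma S1_nonneg: "S1 x0 x \<theta> \<ge> 0"
  unfolding S1_def set_lebesgue_integral_def by (intro Bochner_Integration.integral_nonneg) auto

text \<open>As \<open>\<theta>0\<close> competes in the infimum, the Gronwall bound on
  \<open>S1\<close> at \<open>\<theta>0\<close> also covers \<open>S1\<close> at
  \<open>\<theta>\<close>; the triangle inequality through \<open>x\<close> then accounts for the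
  factor 2.\<close>

lemma estimator_error_le:
  assumes int: "set_integrable lborel {0..1} x" and g: "continuous_on {0..1} g"
    and eq: "\<And>t. t \<in> {0..1} \<Longrightarrow> x t = x0 + \<theta>0 * (LINT s:{0..t}|lborel. x s) + \<epsilon> * g t"
    and bound: "\<And>t. t \<in> {0..1} \<Longrightarrow> \<bar>g t\<bar> \<le> u" and \<epsilon>: "\<epsilon> > 0"
    and \<theta>0: "\<theta>0 \<in> \<Theta>" and min: "S1 x0 x \<theta> = (INF \<theta>\<in>\<Theta>. S1 x0 x \<theta>)"
  shows "(LINT t:{0..1}|lborel. \<bar>ode_sol x0 \<theta> t - ode_sol x0 \<theta>0 t\<bar>) \<le> 2 * (\<epsilon> * u * exp \<bar>\<theta>0\<bar>)"
proof -
  note path = sde_path_bounds[OF int g eq bound \<epsilon>]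
  have "bdd_below (S1 x0 x ` \<Theta>)" by (rule bdd_belowI2[of _ 0]) (rule S1_nonneg)
  then have "S1 x0 x \<theta> \<le> S1 x0 x \<theta>0" unfolding min using \<theta>0 by (rule cINF_lower)
  then show ?thesis
    using ode_sol_dist_le_S1[OF path(1), of x0 \<theta> \<theta>0] path(2) by linarith
qed

section \<open>Exponential rate for the estimation error\<close>

theorem theorem3p1:
  fixes M :: "'a measure" and F :: "real \<Rightarrow> 'a measure"
    and G :: "real \<Rightarrow> 'a \<Rightarrow> real" and X :: "real \<Rightarrow> real \<Rightarrow> 'a \<Rightarrow> real"
    and \<theta>s :: "real \<Rightarrow> 'a \<Rightarrow> real"
    and \<Theta> :: "real set" and x0 \<theta>0 \<sigma>2 m :: real
  assumes basis: "stochastic_basis M F"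
    and G_adapted: "adapted F G"
    and G_gauss: "gaussian_process M G"
    and G_centered: "centered_process M G"
    and G_cont: "continuous_process M G"
    and sigma2: "\<sigma>2 = (SUP t\<in>{0..1}. (\<integral>\<omega>. (G t \<omega>)\<^sup>2 \<partial>M))"
    and m: "m = (\<integral>\<omega>. (SUP t\<in>{0..1}. G t \<omega>) \<partial>M)"
    and theta0: "\<theta>0 \<in> \<Theta>"
    and X_adapted: "\<And>\<epsilon>. \<epsilon> > 0 \<Longrightarrow> adapted F (X \<epsilon>)"
    and X_sol: "\<And>\<epsilon>. \<epsilon> > 0 \<Longrightarrow> solves_sde M x0 \<theta>0 \<epsilon> G (X \<epsilon>)"
    and est: "\<And>\<epsilon>. \<epsilon> > 0 \<Longrightarrow> min_L1_estimator M x0 \<Theta> (X \<epsilon>) (\<theta>s \<epsilon>)"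
  shows "\<exists>C>0. \<forall>\<delta>>0.
    (\<lambda>\<epsilon>. measure M {\<omega> \<in> space M. \<bar>\<theta>s \<epsilon> \<omega> - \<theta>0\<bar> > \<delta>})
      \<in> O[at_right 0](\<lambda>\<epsilon>. exp_rate C (separation x0 \<Theta> \<theta>0 \<delta>) \<epsilon>)"
proof -
  interpret stochastic_basis M F by fact
  note prob = prob_space_axioms
  \<comment> \<open>Countability keeps the exceedance event measurable, and density lets path
    continuity recover all times.\<close>
  define D where "D = {0<..<1} \<inter> (\<rat> :: real set)"
  have D: "countable D" "D \<subseteq> {0..1}"
    unfolding D_def by (rule countable_Int2[OF countable_rat]) auto
  have clD: "closure D = {0..1}" unfolding D_def by (rule closure_Rats_Int_unit)
  obtain s where s: "s > 0" "measure M {\<omega>\<in>space M. \<exists>t\<in>D. \<bar>G t \<omega>\<bar> > s} \<le> 1 / 4"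
    using continuous_process_tight[OF prob G_gauss G_cont D, of "1 / 4"] by auto
  define E where "E = exp \<bar>\<theta>0\<bar>"
  have E: "E > 0" by (simp add: E_def)
  \<comment> \<open>\<open>C\<close> involves only \<open>s\<close> and \<open>\<theta>0\<close>,
    hence serves every \<open>\<delta>\<close>. The number 512 is \<open>32 * 4\<^sup>2\<close>,
    with 32 from the Fernique exponent and 4 from the choice of \<open>u\<close> below.\<close>
  define C where "C = 1 / (512 * s\<^sup>2 * E\<^sup>2)"
  have C: "C > 0" using s E by (simp add: C_def)
  note [measurable] = D(1)
  have Gm [measurable]: "G t \<in> borel_measurable M" if "t \<in> D" for t
    using gaussian_process_measurable[OF G_gauss] D that by auto
  \<comment> \<open>The factor \<open>exp 1\<close> stems from the 1 in the Fernique exponent and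
    becomes the constant of the O-estimate.\<close>
  have bound: "measure M {\<omega>\<in>space M. \<bar>\<theta>s \<epsilon> \<omega> - \<theta>0\<bar> > \<delta>} \<le> exp 1 * exp (- C * r\<^sup>2 / \<epsilon>\<^sup>2)"
    if r: "separation x0 \<Theta> \<theta>0 \<delta> = ereal r" "r > 0" and \<epsilon>: "\<epsilon> > 0" for \<delta> r \<epsilon>
  proof -
    \<comment> \<open>Chosen so that the error bound \<open>2 * (\<epsilon> * u * E)\<close> equals
      \<open>r / 2\<close>, strictly below the infimum \<open>r\<close>.\<close>
    define u where "u = r / (4 * E * \<epsilon>)"
    have u: "u > 0" using r E \<epsilon> by (simp add: u_def)
    have "AE \<omega> in M. continuous_on {0..1} (\<lambda>t. G t \<omega>)"
      using G_cont by (simp add: continuous_process_def)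
    moreover note X_sol[OF \<epsilon>, unfolded solves_sde_def]
    moreover have "AE \<omega> in M. S1 x0 (\<lambda>t. X \<epsilon> t \<omega>) (\<theta>s \<epsilon> \<omega>) = (INF \<theta>\<in>\<Theta>. S1 x0 (\<lambda>t. X \<epsilon> t \<omega>) \<theta>)"
      and \<theta>s: "\<forall>\<omega>\<in>space M. \<theta>s \<epsilon> \<omega> \<in> \<Theta>"
      using est[OF \<epsilon>] by (auto simp: min_L1_estimator_def)
    ultimately have "AE \<omega> in M. \<omega> \<in> {\<omega>\<in>space M. \<bar>\<theta>s \<epsilon> \<omega> - \<theta>0\<bar> > \<delta>} \<longrightarrow>
        \<omega> \<in> {\<omega>\<in>space M. \<exists>t\<in>D. \<bar>G t \<omega>\<bar> > u}"
    proof eventually_elim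
      case (elim \<omega>)
      show ?case
      proof (rule ccontr)
        have \<omega>: "\<omega> \<in> space M" and far: "\<bar>\<theta>s \<epsilon> \<omega> - \<theta>0\<bar> > \<delta>" using elim(4) by auto
        assume "\<omega> \<notin> {\<omega>\<in>space M. \<exists>t\<in>D. \<bar>G t \<omega>\<bar> > u}"
        with \<omega> have uD: "\<bar>G t \<omega>\<bar> \<le> u" if "t \<in> D" for t using that by force
        \<comment> \<open>Continuity carries the bound \<open>u\<close> from \<open>D\<close> to the
          whole unit interval.\<close>
        have "continuous_on (closure D) (\<lambda>t. \<bar>G t \<omega>\<bar>)"
          unfolding clD by (intro continuous_intros elim(1))
        from continuous_le_on_closure[OF this _ uD]
        have "\<bar>G t \<omega>\<bar> \<le> u" if "t \<in> {0..1}" for t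
          using that by (simp add: clD)
        then have "(LINT t:{0..1}|lborel. \<bar>ode_sol x0 (\<theta>s \<epsilon> \<omega>) t - ode_sol x0 \<theta>0 t\<bar>)
            \<le> 2 * (\<epsilon> * u * exp \<bar>\<theta>0\<bar>)"
          using elim \<epsilon> theta0 by (intro estimator_error_le[where x="\<lambda>t. X \<epsilon> t \<omega>" and g="\<lambda>t. G t \<omega>"]) auto
        also have "\<dots> = r / 2" using E \<epsilon> by (simp add: u_def E_def[symmetric])
        finally have "ereal (LINT t:{0..1}|lborel. \<bar>ode_sol x0 (\<theta>s \<epsilon> \<omega>) t - ode_sol x0 \<theta>0 t\<bar>) \<le> ereal (r / 2)"
          by simp
        moreover have "separation x0 \<Theta> \<theta>0 \<delta>
            \<le> ereal (LINT t:{0..1}|lborel. \<bar>ode_sol x0 (\<theta>s \<epsilon> \<omega>) t - ode_sol x0 \<theta>0 t\<bar>)"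
          unfolding separation_def using \<theta>s \<omega> far by (intro INF_lower) auto
        ultimately have "ereal r \<le> ereal (r / 2)" unfolding r(1)[symmetric] by (rule order_trans[rotated])
        then show False using r(2) by simp
      qed
    qed
    then have "measure M {\<omega>\<in>space M. \<bar>\<theta>s \<epsilon> \<omega> - \<theta>0\<bar> > \<delta>}
        \<le> measure M {\<omega>\<in>space M. \<exists>t\<in>D. \<bar>G t \<omega>\<bar> > u}"
      by (rule finite_measure_mono_AE) measurable
    also have "\<dots> \<le> exp (1 - u\<^sup>2 / (32 * s\<^sup>2))"
      using u by (intro gaussian_fernique_tail[OF prob G_gauss G_centered D s]) auto
    also have "u\<^sup>2 / (32 * s\<^sup>2) = C * r\<^sup>2 / \<epsilon>\<^sup>2"
      by (simp add: u_def C_def power_divide power_mult_distrib)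
    finally show ?thesis by (simp add: exp_add[symmetric])
  qed
  show ?thesis
  proof (intro exI[of _ C] conjI C allI impI)
    fix \<delta> :: real assume "\<delta> > 0"
    let ?\<gamma> = "separation x0 \<Theta> \<theta>0 \<delta>"
    have nonneg: "?\<gamma> \<ge> 0"
      unfolding separation_def set_lebesgue_integral_def
      by (intro INF_greatest) (auto intro!: Bochner_Integration.integral_nonneg)
    have "measure M {\<omega>\<in>space M. \<bar>\<theta>s \<epsilon> \<omega> - \<theta>0\<bar> > \<delta>} \<le> exp 1 * exp_rate C ?\<gamma> \<epsilon>"
      if \<epsilon>: "\<epsilon> > 0" for \<epsilon>
    proof (cases ?\<gamma>)
      case (real r)
      show ?thesis
      proof (cases "r = 0")
        case True
        \<comment> \<open>At zero separation the rate equals 1, and any probability is within the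
          factor \<open>exp 1\<close> of it.\<close>
        have "measure M {\<omega>\<in>space M. \<bar>\<theta>s \<epsilon> \<omega> - \<theta>0\<bar> > \<delta>} \<le> 1" by simp
        also have "\<dots> \<le> exp 1" by simp
        finally show ?thesis using real True by (simp add: exp_rate_def)
      next
        case False
        then have "r > 0" using nonneg real by simp
        then show ?thesis using bound[OF real _ \<epsilon>] real by (simp add: exp_rate_def)
      qed
    next
      case PInf
      \<comment> \<open>The integrals are real numbers, so an infinite infimum means an empty index
        set; an estimator with values in \<open>\<Theta>\<close> then never errs by more than
        \<open>\<delta>\<close>.\<close>
      then have "\<not> (\<theta> \<in> \<Theta> \<and> \<bar>\<theta> - \<theta>0\<bar> > \<delta>)" for \<theta>
        unfolding separation_def by (auto simp: Inf_eq_PInfty)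
      then have empty: "{\<omega>\<in>space M. \<bar>\<theta>s \<epsilon> \<omega> - \<theta>0\<bar> > \<delta>} = {}"
        using est[OF \<epsilon>] by (auto simp: min_L1_estimator_def)
      show ?thesis unfolding empty using PInf by (simp add: exp_rate_def)
    next
      case MInf
      then show ?thesis using nonneg by simp
    qed
    then have "\<forall>\<^sub>F \<epsilon> in at_right 0. norm (measure M {\<omega>\<in>space M. \<bar>\<theta>s \<epsilon> \<omega> - \<theta>0\<bar> > \<delta>})
        \<le> exp 1 * norm (exp_rate C ?\<gamma> \<epsilon>)"
      by (auto intro!: eventually_at_right_less[THEN eventually_mono] simp: exp_rate_def)
    then show "(\<lambda>\<epsilon>. measure M {\<omega>\<in>space M. \<bar>\<theta>s \<epsilon> \<omega> - \<theta>0\<bar> > \<delta>})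
      \<in> O[at_right 0](\<lambda>\<epsilon>. exp_rate C ?\<gamma> \<epsilon>)"
      by (rule bigoI)
  qed
qed

end
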